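(* Let $X$ be a non-constant smooth vector field on $\mathbb{H}^2$ and let $\lambda\in\mathbb{R}$. If $(\mathbb{H}^2,ds^2,X,\lambda)$ is a Ricci soliton, then $X$ is a Killing vector field. Moreover, there exist $a,b,c\in\mathbb{R}$ such that \[ X_{(x,y)}=\left(\frac{a}{2}(x^2-y^2)+bx+c\right)\frac{\partial}{\partial x}+(axy+by)\frac{\partial}{\partial y}. \]
   Context: $\mathbb{H}^2=\{(x,y)\in\mathbb{R}^2 : y>0\}$ with the hyperbolic metric $ds^2=\frac{dx^2+dy^2}{y^2}$. A Riemannian manifold $(M,g)$ with Ricci tensor $\mathrm{Ric}$, together with a smooth vector field $X$ and a real constant $\lambda$, is a Ricci soliton if $\mathrm{Ric}+\frac12\mathcal{L}_Xg=\lambda g$, where $\mathcal{L}_X$ is the Lie derivative. A vector field is constant if its components in the coordinates $(x,y)$ are constant functions. *)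

theory Defs
  imports "HOL-Analysis.Analysis"
begin

text \<open>
  Only meant for open \<open>U\<close>, where the ambient derivative \<open>at x\<close> depends on the values of \<open>f\<close>
  in \<open>U\<close> alone.
\<close>

primrec C_k_on :: "nat \<Rightarrow> 'a::euclidean_space set \<Rightarrow> ('a \<Rightarrow> 'b::real_normed_vector) \<Rightarrow> bool" where
  "C_k_on 0 U f \<longleftrightarrow> continuous_on U f"
| "C_k_on (Suc k) U f \<longleftrightarrow> (\<forall>x\<in>U. f differentiable (at x)) \<and>
     (\<forall>v. C_k_on k U (\<lambda>x. frechet_derivative f (at x) v))"

definition smooth_on :: "'a::euclidean_space set \<Rightarrow> ('a \<Rightarrow> 'b::real_normed_vector) \<Rightarrow> bool" where
  "smooth_on U f \<longleftrightarrow> (\<forall>k. C_k_on k U f)"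

text \<open>
  An open set \<open>U\<close> of \<open>real ^ 'n\<close> is a manifold covered by the single chart given by its standard
  coordinates, and all tensors are represented by their components in the coordinate frame:
  a metric \<open>g\<close> by the matrix field \<open>g p $ i $ j\<close>, a vector field \<open>X\<close> by \<open>X p $ i\<close>.
  The values of these functions outside \<open>U\<close> are irrelevant.
\<close>

definition riemannian_metric_on :: "(real ^ 'n) set \<Rightarrow> (real ^ 'n \<Rightarrow> real ^ 'n ^ 'n) \<Rightarrow> bool" where
  "riemannian_metric_on U g \<longleftrightarrow> open U \<and> smooth_on U g \<and>
     (\<forall>p\<in>U. transpose (g p) = g p \<and> (\<forall>v. v \<noteq> 0 \<longrightarrow> v \<bullet> (g p *v v) > 0))"

definition partial :: "'n \<Rightarrow> (real ^ 'n \<Rightarrow> real) \<Rightarrow> real ^ 'n \<Rightarrow> real" where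
  "partial i f p = frechet_derivative f (at p) (axis i 1)"

text \<open>
  \<open>christoffel g l i j\<close> is \<open>\<Gamma>\<close> with upper index \<open>l\<close> and lower indices \<open>i, j\<close>, that is, the
  \<open>l\<close>-th component of the Levi-Civita derivative of the \<open>j\<close>-th along the \<open>i\<close>-th coordinate field.
\<close>

definition christoffel :: "(real ^ 'n \<Rightarrow> real ^ 'n ^ 'n) \<Rightarrow> 'n \<Rightarrow> 'n \<Rightarrow> 'n \<Rightarrow> real ^ 'n \<Rightarrow> real" where
  "christoffel g l i j p = 1 / 2 * (\<Sum>m\<in>UNIV. matrix_inv (g p) $ l $ m *
     (partial i (\<lambda>q. g q $ j $ m) p + partial j (\<lambda>q. g q $ i $ m) p - partial m (\<lambda>q. g q $ i $ j) p))"

text \<open>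
  \<open>riemann_curvature g l k i j\<close> is the \<open>l\<close>-th component of \<open>R(e\<^sub>i, e\<^sub>j) e\<^sub>k\<close>, where
  \<open>R(Y, Z) W = \<nabla>\<^sub>Y \<nabla>\<^sub>Z W - \<nabla>\<^sub>Z \<nabla>\<^sub>Y W - \<nabla>\<^bsub>[Y, Z]\<^esub> W\<close> and \<open>e\<^sub>i\<close> are the coordinate fields;
  the Ricci tensor is the trace of \<open>Y \<mapsto> R(Y, Z) W\<close> (positive on round spheres).
\<close>

definition riemann_curvature ::
    "(real ^ 'n \<Rightarrow> real ^ 'n ^ 'n) \<Rightarrow> 'n \<Rightarrow> 'n \<Rightarrow> 'n \<Rightarrow> 'n \<Rightarrow> real ^ 'n \<Rightarrow> real" where
  "riemann_curvature g l k i j p =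
     partial i (christoffel g l j k) p - partial j (christoffel g l i k) p
     + (\<Sum>m\<in>UNIV. christoffel g l i m p * christoffel g m j k p
                  - christoffel g l j m p * christoffel g m i k p)"

definition ricci :: "(real ^ 'n \<Rightarrow> real ^ 'n ^ 'n) \<Rightarrow> real ^ 'n \<Rightarrow> real ^ 'n ^ 'n" where
  "ricci g p = (\<chi> j k. \<Sum>i\<in>UNIV. riemann_curvature g i k i j p)"

text \<open>
  Components on coordinate fields of
  \<open>(L\<^sub>X g)(Y, Z) = X (g(Y, Z)) - g([X, Y], Z) - g(Y, [X, Z])\<close>.
\<close>

definition lie_derivative_metric ::
    "(real ^ 'n \<Rightarrow> real ^ 'n) \<Rightarrow> (real ^ 'n \<Rightarrow> real ^ 'n ^ 'n) \<Rightarrow> real ^ 'n \<Rightarrow> real ^ 'n ^ 'n" where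
  "lie_derivative_metric X g p = (\<chi> i j. \<Sum>k\<in>UNIV.
     X p $ k * partial k (\<lambda>q. g q $ i $ j) p
     + g p $ k $ j * partial i (\<lambda>q. X q $ k) p
     + g p $ i $ k * partial j (\<lambda>q. X q $ k) p)"

definition ricci_soliton ::
    "(real ^ 'n) set \<Rightarrow> (real ^ 'n \<Rightarrow> real ^ 'n ^ 'n) \<Rightarrow> (real ^ 'n \<Rightarrow> real ^ 'n) \<Rightarrow> real \<Rightarrow> bool" where
  "ricci_soliton U g X lam \<longleftrightarrow> riemannian_metric_on U g \<and> smooth_on U X \<and>
     (\<forall>p\<in>U. ricci g p + (1 / 2) *\<^sub>R lie_derivative_metric X g p = lam *\<^sub>R g p)"

definition killing_field ::
    "(real ^ 'n) set \<Rightarrow> (real ^ 'n \<Rightarrow> real ^ 'n ^ 'n) \<Rightarrow> (real ^ 'n \<Rightarrow> real ^ 'n) \<Rightarrow> bool" where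
  "killing_field U g X \<longleftrightarrow> smooth_on U X \<and> (\<forall>p\<in>U. lie_derivative_metric X g p = 0)"

definition hyperbolic_plane :: "(real ^ 2) set" where
  "hyperbolic_plane = {p. p $ 2 > 0}"

definition hyperbolic_metric :: "real ^ 2 \<Rightarrow> real ^ 2 ^ 2" where
  "hyperbolic_metric p = (\<chi> i j. if i = j then 1 / (p $ 2)\<^sup>2 else 0)"

lemma open_hyperbolic_plane: "open hyperbolic_plane"
  unfolding hyperbolic_plane_def by (intro open_Collect_less continuous_intros)

lemma C_k_on_cong:
  assumes "open U" "\<And>x. x \<in> U \<Longrightarrow> f x = g x"
  shows "C_k_on k U f \<longleftrightarrow> C_k_on k U g"
  using assms(2)
proof (induction k arbitrary: f g)
  case 0
  then show ?case by (simp cong: continuous_on_cong)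
next
  case (Suc k)
  have tr: "(f has_derivative D) (at x) \<longleftrightarrow> (g has_derivative D) (at x)" if "x \<in> U" for x D
    using has_derivative_transform_within_open[OF _ \<open>open U\<close> that] Suc.prems by metis
  then have "frechet_derivative f (at x) = frechet_derivative g (at x)" if "x \<in> U" for x
    using that unfolding frechet_derivative_def by simp
  then have "C_k_on k U (\<lambda>x. frechet_derivative f (at x) v)
      \<longleftrightarrow> C_k_on k U (\<lambda>x. frechet_derivative g (at x) v)" for v
    by (intro Suc.IH) simp
  moreover have "f differentiable (at x) \<longleftrightarrow> g differentiable (at x)" if "x \<in> U" for x
    using tr[OF that] by (simp add: differentiable_def)
  ultimately show ?case by simp
qed

lemma C_k_on_inverse_power:
  "C_k_on k hyperbolic_plane (\<lambda>p. inverse (p $ 2) ^ m *\<^sub>R (A :: 'b::real_normed_vector))"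
proof (induction k arbitrary: m A)
  case 0
  then show ?case by (auto simp: hyperbolic_plane_def intro!: continuous_intros)
next
  case (Suc k)
  let ?f = "\<lambda>p::real^2. inverse (p $ 2) ^ m *\<^sub>R A"
  have D: "(?f has_derivative (\<lambda>v. inverse (p $ 2) ^ Suc m *\<^sub>R ((- real m * v $ 2) *\<^sub>R A))) (at p)"
    if "p \<in> hyperbolic_plane" for p
  proof -
    have "p $ 2 \<noteq> 0" using that by (auto simp: hyperbolic_plane_def)
    then have "((\<lambda>t. inverse t ^ m) has_real_derivative
        real m * - (inverse (p $ 2) ^ Suc (Suc 0)) * inverse (p $ 2) ^ (m - 1)) (at (p $ 2))"
      using DERIV_power[OF DERIV_inverse, of "p $ 2" m UNIV] by (simp add: mult_ac)
    moreover have "real m * - (t ^ Suc (Suc 0)) * t ^ (m - 1) = - real m * t ^ Suc m" for t :: real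
      by (cases m) (simp_all add: algebra_simps)
    ultimately have "((\<lambda>t. inverse t ^ m) has_real_derivative - real m * inverse (p $ 2) ^ Suc m) (at (p $ 2))"
      by (simp only:)
    then have "((\<lambda>t. inverse t ^ m) has_derivative (*) (- real m * inverse (p $ 2) ^ Suc m)) (at (p $ 2))"
      by (simp add: has_field_derivative_def)
    moreover have "((\<lambda>q::real^2. q $ 2) has_derivative (\<lambda>v. v $ 2)) (at p)"
      by (intro bounded_linear.has_derivative[OF bounded_linear_vec_nth] has_derivative_ident)
    ultimately have "((\<lambda>q. inverse (q $ 2) ^ m) has_derivative
        (\<lambda>v. - real m * inverse (p $ 2) ^ Suc m * v $ 2)) (at p)"
      by (rule has_derivative_compose[rotated])
    from has_derivative_scaleR_left[OF this, of A] show ?thesis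
      by (simp add: mult_ac)
  qed
  then have "frechet_derivative ?f (at p) v = inverse (p $ 2) ^ Suc m *\<^sub>R ((- real m * v $ 2) *\<^sub>R A)"
    if "p \<in> hyperbolic_plane" for p v
    using frechet_derivative_at[OF D[OF that], symmetric] by simp
  then have "C_k_on k hyperbolic_plane (\<lambda>p. frechet_derivative ?f (at p) v)" for v
    by (subst C_k_on_cong[OF open_hyperbolic_plane]) (assumption, rule Suc.IH)
  with D show ?case by (auto simp: differentiable_def)
qed

lemma riemannian_hyperbolic_metric: "riemannian_metric_on hyperbolic_plane hyperbolic_metric"
proof -
  have eq: "hyperbolic_metric p = inverse (p $ 2) ^ 2 *\<^sub>R mat 1" for p
    by (simp add: hyperbolic_metric_def mat_def vec_eq_iff field_simps)
  have "hyperbolic_metric p *v v = inverse (p $ 2) ^ 2 *\<^sub>R v" for p v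
    unfolding eq by (simp add: scaleR_matrix_vector_assoc[symmetric])
  then have "v \<bullet> (hyperbolic_metric p *v v) > 0" if "p \<in> hyperbolic_plane" "v \<noteq> 0" for p v
    using that by (simp add: hyperbolic_plane_def)
  moreover have "smooth_on hyperbolic_plane hyperbolic_metric"
    unfolding smooth_on_def eq by (intro allI C_k_on_inverse_power)
  moreover have "transpose (hyperbolic_metric p) = hyperbolic_metric p" for p
    by (auto simp: hyperbolic_metric_def transpose_def vec_eq_iff)
  ultimately show ?thesis
    by (simp add: riemannian_metric_on_def open_hyperbolic_plane)
qed

end

theory Submission
  imports Defs
begin

text \<open>
  The hyperbolic plane is Einstein with \<open>Ric = -g\<close> (lemma \<open>ricci_hyperbolic_metric\<close>), so a soliton
  is a field with \<open>L\<^sub>X g = 2 m g\<close>, where \<open>m = lam + 1\<close>: the flow of \<open>X\<close> scales the metric.  Constant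
  nonzero curvature forbids such scaling unless \<open>m = 0\<close>.  In coordinates, with \<open>X = (u, v)\<close>, the
  equation is the first-order system
  \<open>u\<^sub>x = v / y + m\<close>, \<open>v\<^sub>y = v / y + m\<close>, \<open>u\<^sub>y + v\<^sub>x = 0\<close>
  (lemma \<open>homothety_equations\<close>), which lemma \<open>homothety_system\<close> solves explicitly.

  The second equation integrates to \<open>v = y (m ln y + h(x))\<close>.  Then \<open>u\<^sub>x = m ln y + h(x) + m\<close> and
  \<open>u\<^sub>y = - y h'(x)\<close>, and evaluating the increments of \<open>u\<close> around a rectangle gives
  \<open>m x ln y = - (y\<^sup>2 - 1) / 2 (h'(x) - h'(0))\<close>.
  As functions of \<open>y\<close>, the logarithm and \<open>y\<^sup>2 - 1\<close> are linearly independent; so \<open>m = 0\<close>, which is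
  the Killing equation, and \<open>h'\<close> is constant, which makes \<open>h\<close> affine and gives the formula for \<open>X\<close>.
\<close>

section \<open>Partial derivatives\<close>

lemma partial_eqI:
  assumes "(f has_derivative D) (at p)"
  shows "partial i f p = D (axis i 1)"
  using frechet_derivative_at[OF assms] by (simp add: partial_def)

lemma partial_cong_open:
  assumes "open U" "p \<in> U" "\<And>q. q \<in> U \<Longrightarrow> f q = g q"
  shows "partial i f p = partial i g p"
proof -
  have "(f has_derivative D) (at p) \<longleftrightarrow> (g has_derivative D) (at p)" for D
    using has_derivative_transform_within_open[OF _ assms(1,2)] assms(3) by metis
  then show ?thesis by (simp add: partial_def frechet_derivative_def)
qed

lemma partial_of_coordinate:
  fixes p :: "real ^ 'n"
  assumes "(\<phi> has_real_derivative d) (at (p $ j))"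
  shows "partial i (\<lambda>q. \<phi> (q $ j)) p = (if i = j then d else 0)"
proof -
  have "((\<lambda>q::real^'n. q $ j) has_derivative (\<lambda>v. v $ j)) (at p)"
    by (intro bounded_linear.has_derivative[OF bounded_linear_vec_nth] has_derivative_ident)
  moreover have "(\<phi> has_derivative (*) d) (at (p $ j))"
    using assms by (simp add: has_field_derivative_def)
  ultimately have "((\<lambda>q. \<phi> (q $ j)) has_derivative (\<lambda>v. d * v $ j)) (at p)"
    by (rule has_derivative_compose)
  from partial_eqI[OF this] show ?thesis by (simp add: axis_def)
qed

lemma has_real_derivative_along_line:
  assumes "f differentiable (at (L s))"
    and "(L has_derivative (\<lambda>h. h *\<^sub>R axis i 1)) (at s)"
  shows "((\<lambda>t. f (L t)) has_real_derivative partial i f (L s)) (at s)"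
proof -
  let ?D = "frechet_derivative f (at (L s))"
  have D: "(f has_derivative ?D) (at (L s))"
    using assms(1) frechet_derivative_works by blast
  then interpret bounded_linear ?D by (rule has_derivative_bounded_linear)
  have "((\<lambda>t. f (L t)) has_derivative (\<lambda>h. ?D (h *\<^sub>R axis i 1))) (at s)"
    by (rule has_derivative_compose[OF assms(2) D])
  moreover have "(\<lambda>h. ?D (h *\<^sub>R axis i 1)) = (*) (partial i f (L s))"
    by (auto simp: partial_def scaleR)
  ultimately show ?thesis by (simp add: has_field_derivative_def)
qed

lemma has_derivative_coordinate_lines:
  "((\<lambda>t. vector [t, y] :: real^2) has_derivative (\<lambda>h. h *\<^sub>R axis 1 1)) (at x)"
  "((\<lambda>t. vector [x, t] :: real^2) has_derivative (\<lambda>h. h *\<^sub>R axis 2 1)) (at y)"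
proof -
  have *: "(vector [a, b] :: real^2) = a *\<^sub>R axis 1 1 + b *\<^sub>R axis 2 1" for a b
    by (simp add: vec_eq_iff forall_2 axis_def)
  show "((\<lambda>t. vector [t, y] :: real^2) has_derivative (\<lambda>h. h *\<^sub>R axis 1 1)) (at x)"
       "((\<lambda>t. vector [x, t] :: real^2) has_derivative (\<lambda>h. h *\<^sub>R axis 2 1)) (at y)"
    unfolding * by (auto intro!: derivative_eq_intros)
qed

section \<open>Curvature of the hyperbolic plane\<close>

lemma partial_hyperbolic_metric:
  assumes "p \<in> hyperbolic_plane"
  shows "partial k (\<lambda>q. hyperbolic_metric q $ i $ j) p
    = (if i = j \<and> k = 2 then - 2 / (p $ 2) ^ 3 else 0)"
proof -
  have "p $ 2 \<noteq> 0" using assms by (auto simp: hyperbolic_plane_def)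
  then have "((\<lambda>t. if i = j then 1 / t\<^sup>2 else 0) has_real_derivative
      (if i = j then - 2 / (p $ 2) ^ 3 else 0)) (at (p $ 2))"
    by (auto intro!: derivative_eq_intros simp: field_simps power2_eq_square power3_eq_cube)
  from partial_of_coordinate[OF this] show ?thesis
    by (simp add: hyperbolic_metric_def)
qed

lemma matrix_inv_eqI:
  fixes A B :: "'a::semiring_1 ^ 'n ^ 'n"
  assumes "A ** B = mat 1" "B ** A = mat 1"
  shows "matrix_inv A = B"
  unfolding matrix_inv_def
proof (rule some_equality)
  show "C = B" if "A ** C = mat 1 \<and> C ** A = mat 1" for C
    using that assms by (metis matrix_mul_assoc matrix_mul_lid matrix_mul_rid)
qed (use assms in simp)

lemma matrix_inv_hyperbolic_metric:
  assumes "p \<in> hyperbolic_plane"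
  shows "matrix_inv (hyperbolic_metric p) $ i $ j = (if i = j then (p $ 2)\<^sup>2 else 0)"
proof -
  have nz: "p $ 2 \<noteq> 0" using assms by (auto simp: hyperbolic_plane_def)
  have "matrix_inv (hyperbolic_metric p) = (\<chi> i j. if i = j then (p $ 2)\<^sup>2 else 0)"
    by (rule matrix_inv_eqI)
      (use nz in \<open>simp_all add: vec_eq_iff forall_2 sum_2 matrix_matrix_mult_def mat_def
        hyperbolic_metric_def\<close>)
  then show ?thesis by simp
qed

lemma christoffel_hyperbolic_metric:
  assumes "p \<in> hyperbolic_plane"
  shows "christoffel hyperbolic_metric l i j p =
    - (of_bool (j = l \<and> i = 2) + of_bool (i = l \<and> j = 2) - of_bool (i = j \<and> l = 2)) / p $ 2"
proof -
  have nz: "p $ 2 \<noteq> 0" using assms by (auto simp: hyperbolic_plane_def)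
  have "l = 1 \<or> l = 2" "i = 1 \<or> i = 2" "j = 1 \<or> j = 2"
    using exhaust_2 by auto
  with nz show ?thesis
    unfolding christoffel_def sum_2 partial_hyperbolic_metric[OF assms]
      matrix_inv_hyperbolic_metric[OF assms]
    by (elim disjE; simp add: field_simps power2_eq_square power3_eq_cube)
qed

lemma partial_christoffel_hyperbolic_metric:
  assumes "p \<in> hyperbolic_plane"
  shows "partial k (christoffel hyperbolic_metric l i j) p =
    (if k = 2 then (of_bool (j = l \<and> i = 2) + of_bool (i = l \<and> j = 2) - of_bool (i = j \<and> l = 2))
       / (p $ 2)\<^sup>2 else 0)"
proof -
  let ?c = "of_bool (j = l \<and> i = 2) + of_bool (i = l \<and> j = 2) - of_bool (i = j \<and> l = 2) :: real"
  have "p $ 2 \<noteq> 0" using assms by (auto simp: hyperbolic_plane_def)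
  then have "((\<lambda>t. - ?c / t) has_real_derivative ?c / (p $ 2)\<^sup>2) (at (p $ 2))"
    by - (rule derivative_eq_intros refl | simp add: power2_eq_square)+
  from partial_of_coordinate[OF this, of k]
  have "partial k (\<lambda>q. - ?c / q $ 2) p = (if k = 2 then ?c / (p $ 2)\<^sup>2 else 0)" .
  moreover have "partial k (christoffel hyperbolic_metric l i j) p = partial k (\<lambda>q. - ?c / q $ 2) p"
    by (rule partial_cong_open[OF open_hyperbolic_plane assms christoffel_hyperbolic_metric])
  ultimately show ?thesis by (simp only:)
qed

text \<open>The Gauss curvature is \<open>-1\<close>, and in dimension two \<open>Ric\<close> is the Gauss curvature times \<open>g\<close>.\<close>

lemma ricci_hyperbolic_metric:
  assumes "p \<in> hyperbolic_plane"
  shows "ricci hyperbolic_metric p = - hyperbolic_metric p"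
proof -
  have nz: "p $ 2 \<noteq> 0" using assms by (auto simp: hyperbolic_plane_def)
  show ?thesis
    unfolding vec_eq_iff forall_2 ricci_def riemann_curvature_def sum_2
      christoffel_hyperbolic_metric[OF assms] partial_christoffel_hyperbolic_metric[OF assms]
    using nz by (simp add: hyperbolic_metric_def field_simps power2_eq_square)
qed

section \<open>The soliton equation as a first-order system\<close>

lemma homothety_equations:
  assumes p: "p \<in> hyperbolic_plane"
    and eq: "lie_derivative_metric X hyperbolic_metric p = (2 * m) *\<^sub>R hyperbolic_metric p"
  shows "partial 1 (\<lambda>q. X q $ 1) p = X p $ 2 / p $ 2 + m"
    and "partial 2 (\<lambda>q. X q $ 2) p = X p $ 2 / p $ 2 + m"
    and "partial 2 (\<lambda>q. X q $ 1) p = - partial 1 (\<lambda>q. X q $ 2) p"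
proof -
  have nz: "p $ 2 \<noteq> 0" using p by (auto simp: hyperbolic_plane_def)
  have c: "lie_derivative_metric X hyperbolic_metric p $ i $ j
      = 2 * m * hyperbolic_metric p $ i $ j" for i j
    using eq by simp
  \<comment> \<open>The metric is unfolded only after its partial derivatives have been evaluated.\<close>
  note lie = c[unfolded lie_derivative_metric_def sum_2 vec_lambda_beta
      partial_hyperbolic_metric[OF p], unfolded hyperbolic_metric_def]
  note alg = divide_simps power2_eq_square power3_eq_cube
  show "partial 1 (\<lambda>q. X q $ 1) p = X p $ 2 / p $ 2 + m"
    using lie[of 1 1] nz by (simp add: alg) algebra?
  show "partial 2 (\<lambda>q. X q $ 2) p = X p $ 2 / p $ 2 + m"
    using lie[of 2 2] nz by (simp add: alg) algebra?
  show "partial 2 (\<lambda>q. X q $ 1) p = - partial 1 (\<lambda>q. X q $ 2) p"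
    using lie[of 1 2] nz by (simp add: alg) algebra?
qed

section \<open>Conformal factor and explicit form of homothetic fields\<close>

lemma same_derivative_half_line:
  fixes f g :: "real \<Rightarrow> real"
  assumes "\<And>t. t > 0 \<Longrightarrow> (f has_real_derivative d t) (at t)"
    and "\<And>t. t > 0 \<Longrightarrow> (g has_real_derivative d t) (at t)"
    and "s > 0" "t > 0"
  shows "f t - g t = f s - g s"
proof -
  have "((\<lambda>t. f t - g t) has_real_derivative 0) (at r within {0<..})" if "r \<in> {0<..}" for r
    using DERIV_diff[OF assms(1,2)] that by (auto intro: has_field_derivative_at_within)
  then obtain c where "\<forall>r\<in>{0<..}. f r - g r = c"
    using has_field_derivative_zero_constant[of "{0<..}" "\<lambda>t. f t - g t"] by auto
  with assms(3,4) show ?thesis by simp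
qed

lemma same_derivative_line:
  fixes f g :: "real \<Rightarrow> real"
  assumes "\<And>t. (f has_real_derivative d t) (at t)"
    and "\<And>t. (g has_real_derivative d t) (at t)"
  shows "f t - g t = f s - g s"
  using DERIV_isconst_all[of "\<lambda>t. f t - g t" t s] DERIV_diff[OF assms] by simp

text \<open>
  The compatibility condition \<open>u\<^sub>x\<^sub>y = u\<^sub>y\<^sub>x\<close> enters in integrated form: the increment
  \<open>u(x,y) - u(x,1)\<close> is computed by integrating \<open>u\<^sub>y\<close>, and its variation in \<open>x\<close> by integrating \<open>u\<^sub>x\<close>.
  Thus first derivatives suffice, and no regularity of \<open>h'\<close> is assumed.
\<close>

lemma homothety_system:
  fixes u v w :: "real \<Rightarrow> real \<Rightarrow> real"
  assumes ux: "\<And>x y. y > 0 \<Longrightarrow> ((\<lambda>t. u t y) has_real_derivative v x y / y + m) (at x)"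
    and uy: "\<And>x y. y > 0 \<Longrightarrow> (u x has_real_derivative - w x y) (at y)"
    and vx: "\<And>x y. y > 0 \<Longrightarrow> ((\<lambda>t. v t y) has_real_derivative w x y) (at x)"
    and vy: "\<And>x y. y > 0 \<Longrightarrow> (v x has_real_derivative v x y / y + m) (at y)"
  shows "m = 0"
    and "\<exists>a b c. \<forall>x y. y > 0 \<longrightarrow>
      u x y = a / 2 * (x\<^sup>2 - y\<^sup>2) + b * x + c \<and> v x y = a * x * y + b * y"
proof -
  define h where "h x = v x 1" for x
  define h' where "h' x = w x 1" for x
  have v_eq: "v x y = y * (m * ln y + h x)" if y: "y > 0" for x y
  proof -
    have "v x y / y - m * ln y = v x 1 / 1 - m * ln 1"
    proof (rule same_derivative_half_line[where d = "\<lambda>y. m / y"])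
      show "((\<lambda>y. v x y / y) has_real_derivative m / t) (at t)" if "t > 0" for t
        by (rule derivative_eq_intros vy that refl)+ (use that in \<open>auto simp: field_simps\<close>)
      show "((\<lambda>y. m * ln y) has_real_derivative m / t) (at t)" if "t > 0" for t
        using that by (auto intro!: derivative_eq_intros)
    qed (use y in auto)
    then show ?thesis using y by (simp add: h_def field_simps)
  qed
  have h_deriv: "(h has_real_derivative h' x) (at x)" for x
    using vx[of 1 x] by (simp add: h_def[abs_def] h'_def)
  have w_eq: "w x y = y * h' x" if y: "y > 0" for x y
  proof -
    have "((\<lambda>t. y * (m * ln y + h t)) has_real_derivative y * h' x) (at x)"
      by (rule derivative_eq_intros h_deriv refl)+ simp
    then have "((\<lambda>t. v t y) has_real_derivative y * h' x) (at x)"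
      by (simp add: v_eq[OF y])
    then show ?thesis using vx[OF y] DERIV_unique by blast
  qed
  have incr_y: "u x y - u x 1 = - (y\<^sup>2 - 1) / 2 * h' x" if y: "y > 0" for x y
  proof -
    have "u x y - (- y\<^sup>2 / 2 * h' x) = u x 1 - (- 1\<^sup>2 / 2 * h' x)"
    proof (rule same_derivative_half_line[where d = "\<lambda>t. - t * h' x"])
      show "(u x has_real_derivative - t * h' x) (at t)" if "t > 0" for t
        using uy[OF that] by (simp add: w_eq[OF that])
      show "((\<lambda>t. - t\<^sup>2 / 2 * h' x) has_real_derivative - t * h' x) (at t)" for t
        by (auto intro!: derivative_eq_intros)
    qed (use y in auto)
    then show ?thesis by (simp add: field_simps)
  qed
  \<comment> \<open>The increment of \<open>u\<close> around the rectangle with opposite corners \<open>(0, 1)\<close> and \<open>(x, y)\<close>.\<close>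
  have rectangle: "m * x * ln y = - (y\<^sup>2 - 1) / 2 * (h' x - h' 0)" if y: "y > 0" for x y
  proof -
    have "(u x y - u x 1) - m * x * ln y = (u 0 y - u 0 1) - m * 0 * ln y"
    proof (rule same_derivative_line[where d = "\<lambda>_. m * ln y"])
      have "((\<lambda>t. u t y - u t 1) has_real_derivative (v t y / y + m) - (v t 1 / 1 + m)) (at t)" for t
        by (intro DERIV_diff ux) (use y in auto)
      then show "((\<lambda>t. u t y - u t 1) has_real_derivative m * ln y) (at t)" for t
        using y by (simp add: v_eq)
      show "((\<lambda>t. m * t * ln y) has_real_derivative m * ln y) (at t)" for t
        by (auto intro!: derivative_eq_intros)
    qed
    then show ?thesis by (simp add: incr_y[OF y] field_simps)
  qed
  show m0: "m = 0"
  proof -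
    \<comment> \<open>The sides at \<open>y = 2\<close> and \<open>y = 4\<close> are in ratio \<open>2\<close> on the left and \<open>5\<close> on the right.\<close>
    have "ln (4::real) = 2 * ln 2"
      using ln_realpow[of 2 2] by simp
    then have "2 * (m * ln 2) = - 15 / 2 * (h' 1 - h' 0)"
      using rectangle[of 4 1] by simp
    moreover have "m * ln 2 = - 3 / 2 * (h' 1 - h' 0)"
      using rectangle[of 2 1] by simp
    ultimately have "m * ln 2 = 0" by linarith
    then show ?thesis by simp
  qed
  define a where "a = h' 0"
  have h'_const: "h' x = a" for x
    using rectangle[of 2 x] by (simp add: m0 a_def)
  have h_eq: "h x = a * x + h 0" for x
  proof -
    have "h x - a * x = h 0 - a * 0"
      by (rule same_derivative_line[where d = "\<lambda>_. a"])
        (use h_deriv in \<open>auto simp: h'_const intro!: derivative_eq_intros\<close>)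
    then show ?thesis by simp
  qed
  have u1_eq: "u x 1 = a / 2 * x\<^sup>2 + h 0 * x + u 0 1" for x
  proof -
    have "u x 1 - (a / 2 * x\<^sup>2 + h 0 * x) = u 0 1 - (a / 2 * 0\<^sup>2 + h 0 * 0)"
    proof (rule same_derivative_line[where d = "\<lambda>t. a * t + h 0"])
      show "((\<lambda>t. u t 1) has_real_derivative a * t + h 0) (at t)" for t
        using ux[of 1 t] by (simp add: v_eq m0 h_eq[of t])
      show "((\<lambda>t. a / 2 * t\<^sup>2 + h 0 * t) has_real_derivative a * t + h 0) (at t)" for t
        by (auto intro!: derivative_eq_intros)
    qed
    then show ?thesis by simp
  qed
  show "\<exists>a b c. \<forall>x y. y > 0 \<longrightarrow>
      u x y = a / 2 * (x\<^sup>2 - y\<^sup>2) + b * x + c \<and> v x y = a * x * y + b * y"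
  proof (intro exI allI impI conjI)
    fix x y :: real assume y: "y > 0"
    show "u x y = a / 2 * (x\<^sup>2 - y\<^sup>2) + h 0 * x + (u 0 1 + a / 2)"
      using incr_y[OF y, of x] by (simp add: u1_eq[of x] h'_const field_simps)
    show "v x y = a * x * y + h 0 * y"
      using v_eq[OF y, of x] by (simp add: m0 h_eq[of x] algebra_simps)
  qed
qed

theorem corollary3p5:
  fixes X :: "real ^ 2 \<Rightarrow> real ^ 2" and lam :: real
  assumes "smooth_on hyperbolic_plane X"
    and "\<not> X constant_on hyperbolic_plane"
    and "ricci_soliton hyperbolic_plane hyperbolic_metric X lam"
  shows "killing_field hyperbolic_plane hyperbolic_metric X \<and>
    (\<exists>a b c. \<forall>x y. vector [x, y] \<in> hyperbolic_plane \<longrightarrow>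
       X (vector [x, y]) = vector [a / 2 * (x\<^sup>2 - y\<^sup>2) + b * x + c, a * x * y + b * y])"
proof -
  define m where "m = lam + 1"
  have lie: "lie_derivative_metric X hyperbolic_metric p = (2 * m) *\<^sub>R hyperbolic_metric p"
    if p: "p \<in> hyperbolic_plane" for p
  proof -
    have "(1 / 2) *\<^sub>R lie_derivative_metric X hyperbolic_metric p = m *\<^sub>R hyperbolic_metric p"
      using assms(3) p ricci_hyperbolic_metric[OF p]
      by (auto simp: ricci_soliton_def m_def algebra_simps)
    from arg_cong[OF this, of "\<lambda>A. 2 *\<^sub>R A"] show ?thesis by simp
  qed
  have H: "vector [x, y] \<in> hyperbolic_plane \<longleftrightarrow> y > 0" for x y
    by (simp add: hyperbolic_plane_def)
  have "C_k_on (Suc 0) hyperbolic_plane X"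
    using assms(1) unfolding smooth_on_def by blast
  then have "X differentiable (at p)" if "p \<in> hyperbolic_plane" for p
    using that by simp
  then have diff: "(\<lambda>q. X q $ i) differentiable (at (vector [x, y]))" if "y > 0" for i x y
    using that H bounded_linear.has_derivative[OF bounded_linear_vec_nth]
    unfolding differentiable_def by blast
  let ?u = "\<lambda>x y. X (vector [x, y]) $ 1" and ?v = "\<lambda>x y. X (vector [x, y]) $ 2"
  let ?w = "\<lambda>x y. partial 1 (\<lambda>q. X q $ 2) (vector [x, y])"
  note eqs = homothety_equations[OF _ lie, of "vector [x, y]" for x y :: real, simplified]
  have along_x: "((\<lambda>t. X (vector [t, y]) $ i) has_real_derivative
      partial 1 (\<lambda>q. X q $ i) (vector [x, y])) (at x)" if "y > 0" for i x y
    by (rule has_real_derivative_along_line[OF diff[OF that] has_derivative_coordinate_lines(1)])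
  have along_y: "((\<lambda>t. X (vector [x, t]) $ i) has_real_derivative
      partial 2 (\<lambda>q. X q $ i) (vector [x, y])) (at y)" if "y > 0" for i x y
    by (rule has_real_derivative_along_line[OF diff[OF that] has_derivative_coordinate_lines(2)])
  have ux: "((\<lambda>t. ?u t y) has_real_derivative ?v x y / y + m) (at x)" if "y > 0" for x y
    using along_x[OF that, where i = 1 and x = x] eqs(1)[of x y] that by (simp add: H)
  have uy: "(?u x has_real_derivative - ?w x y) (at y)" if "y > 0" for x y
    using along_y[OF that, where i = 1 and x = x] eqs(3)[of x y] that by (simp add: H)
  have vx: "((\<lambda>t. ?v t y) has_real_derivative ?w x y) (at x)" if "y > 0" for x y
    using along_x[OF that, where i = 2 and x = x] by simp
  have vy: "(?v x has_real_derivative ?v x y / y + m) (at y)" if "y > 0" for x y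
    using along_y[OF that, where i = 2 and x = x] eqs(2)[of x y] that by (simp add: H)
  have "m = 0"
    by (rule homothety_system(1)[of ?u ?v m ?w]) (fact ux uy vx vy)+
  then have "killing_field hyperbolic_plane hyperbolic_metric X"
    using assms(1) lie by (simp add: killing_field_def)
  moreover have "\<exists>a b c. \<forall>x y. y > 0 \<longrightarrow>
      ?u x y = a / 2 * (x\<^sup>2 - y\<^sup>2) + b * x + c \<and> ?v x y = a * x * y + b * y"
    by (rule homothety_system(2)[of ?u ?v m ?w]) (fact ux uy vx vy)+
  ultimately show ?thesis
    by (simp add: H vec_eq_iff forall_2)
qed

end
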